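(* Let $(x,y)\in\mathbb{R}^2$ and $2\pi>\theta_1>\theta_2>0$. For $k=1,2$ let $r_k=R(x,y,\theta_k)$ and suppose $(r_k,\theta_k)$ is a left turn-to-bearing path through $(x,y)$ approaching with angle $\theta_k$, i.e. $r_k>0$ and $H_{r_k,\theta_k}(d_k)=(x,y)$ for some $d_k\ge r_k\theta_k$. Then $R(x,y,\theta_1)>R(x,y,\theta_2)$.
   Context: $R(x,y,\theta)=\dfrac{x\sin\theta-y\cos\theta}{1-\cos\theta}$. For $r>0$ and $0<\theta_c<2\pi$, the left turn-to-bearing path from the origin with initial heading along $+x$ is, for $d\ge0$, $H_{r,\theta_c}(d)=(r\sin(d/r),\ r(1-\cos(d/r)))$ if $d\le r\theta_c$ and $H_{r,\theta_c}(d)=((d-r\theta_c)\cos\theta_c+r\sin\theta_c,\ (d-r\theta_c)\sin\theta_c+r(1-\cos\theta_c))$ if $d>r\theta_c$. *)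

theory Defs
  imports Complex_Main
begin

definition turn_radius :: "real \<Rightarrow> real \<Rightarrow> real \<Rightarrow> real" where
  "turn_radius x y \<theta> = (x * sin \<theta> - y * cos \<theta>) / (1 - cos \<theta>)"

text \<open>The path is meant for \<open>r > 0\<close>, \<open>0 < \<theta>c < 2 * pi\<close> and \<open>d \<ge> 0\<close>; \<open>d\<close> is arc length.\<close>

definition left_turn_path :: "real \<Rightarrow> real \<Rightarrow> real \<Rightarrow> real \<times> real" where
  "left_turn_path r \<theta>c d =
    (if d \<le> r * \<theta>c
     then (r * sin (d / r), r * (1 - cos (d / r)))
     else ((d - r * \<theta>c) * cos \<theta>c + r * sin \<theta>c,
           (d - r * \<theta>c) * sin \<theta>c + r * (1 - cos \<theta>c)))"

text \<open>
  The condition \<open>d \<ge> r * \<theta>c\<close> says that the point is reached once the turn is complete, so that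
  the heading there is \<open>\<theta>c\<close>; the endpoint of the arc itself is included.
\<close>

definition left_turn_path_approaching :: "real \<Rightarrow> real \<Rightarrow> real \<times> real \<Rightarrow> bool" where
  "left_turn_path_approaching r \<theta>c p \<longleftrightarrow>
    r > 0 \<and> 0 < \<theta>c \<and> \<theta>c < 2 * pi \<and> (\<exists>d \<ge> r * \<theta>c. left_turn_path r \<theta>c d = p)"

end

theory Submission
  imports Defs
begin

text \<open>
  Put \<open>t = cot (\<theta> / 2)\<close>, which is strictly decreasing on \<open>0 < \<theta> < 2 * pi\<close>. The turn radius becomes the
  quadratic \<open>x * t - y * (t\<^sup>2 - 1) / 2\<close>, and the length of the straight final leg is \<open>y * t - x\<close>.
  Hence \<open>R(\<theta>1) - R(\<theta>2) = (t2 - t1) * ((y * t1 - x) + (y * t2 - x)) / 2\<close> is a product of a positive and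
  a nonnegative factor, the latter vanishing only for \<open>x = y = 0\<close>, where the turn radius is not positive.
\<close>

text \<open>The difference \<open>cot a - cot b\<close> equals
  \<open>sin (b - a) / (sin a * sin b)\<close>, and all three sines are positive.\<close>

lemma cot_strict_antimono:
  fixes a b :: real
  assumes "0 < a" "a < b" "b < pi"
  shows "cot b < cot a"
proof -
  have "0 < sin a" "0 < sin b" "0 < sin (b - a)"
    using assms by (auto intro: sin_gt_zero)
  then show ?thesis
    by (simp add: cot_def field_simps sin_diff)
qed

text \<open>Double-angle formulas for \<open>\<theta> / 2\<close>. The product form stays valid at
  \<open>\<theta> = pi\<close>, where \<open>sin \<theta>\<close> vanishes.\<close>

lemma cot_half:
  fixes \<theta> :: real
  assumes "0 < \<theta>" "\<theta> < 2 * pi"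
  shows one_minus_cos_cot_half: "(1 - cos \<theta>) * cot (\<theta> / 2) = sin \<theta>"
    and sin_cot_half: "sin \<theta> * cot (\<theta> / 2) = 1 + cos \<theta>"
proof -
  have s: "sin (\<theta> / 2) \<noteq> 0"
    using sin_gt_zero[of "\<theta> / 2"] assms by simp
  show "(1 - cos \<theta>) * cot (\<theta> / 2) = sin \<theta>"
    using cos_double_sin[of "\<theta> / 2"] sin_double[of "\<theta> / 2"] s
    by (simp add: cot_def power2_eq_square)
  show "sin \<theta> * cot (\<theta> / 2) = 1 + cos \<theta>"
    using cos_double_cos[of "\<theta> / 2"] sin_double[of "\<theta> / 2"] s
    by (simp add: cot_def power2_eq_square)
qed

lemma turn_radius_cot_half:
  assumes "0 < \<theta>" "\<theta> < 2 * pi"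
  shows "turn_radius x y \<theta> = x * cot (\<theta> / 2) - y * ((cot (\<theta> / 2))\<^sup>2 - 1) / 2"
proof -
  define t k where "t = cot (\<theta> / 2)" and "k = 1 - cos \<theta>"
  have k: "k \<noteq> 0"
    using assms sin_gt_zero[of "\<theta> / 2"] cos_double_sin[of "\<theta> / 2"]
    by (simp add: k_def)
  have sin: "sin \<theta> = k * t"
    using one_minus_cos_cot_half[OF assms] by (simp add: k_def t_def)
  \<comment> \<open>The left side is \<open>sin \<theta> * t\<close>, hence
    \<open>1 + cos \<theta>\<close>. So \<open>cos \<theta>\<close>, like
    \<open>sin \<theta>\<close>, is a multiple of \<open>k\<close>, and the denominator of the turn
    radius cancels.\<close>
  have "k * t * t = 2 - k"
    using sin_cot_half[OF assms] sin by (simp add: k_def t_def)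
  moreover have "k * ((t\<^sup>2 - 1) / 2) = (k * t * t - k) / 2"
    by (simp add: power2_eq_square algebra_simps)
  ultimately have cos: "cos \<theta> = k * ((t\<^sup>2 - 1) / 2)"
    by (simp add: k_def)
  have "x * sin \<theta> - y * cos \<theta> = (x * t - y * (t\<^sup>2 - 1) / 2) * k"
    unfolding sin cos by (simp add: algebra_simps)
  then show ?thesis
    using k by (simp add: turn_radius_def k_def t_def)
qed

text \<open>The half-angle identities collapse the right side to \<open>x + s\<close>, where
  \<open>s\<close> is the distance travelled straight after the turn.\<close>

lemma approaching_final_leg_nonneg:
  assumes "left_turn_path_approaching r \<theta> (x, y)"
  shows "x \<le> y * cot (\<theta> / 2)"
proof -
  have r: "r > 0" and \<theta>: "0 < \<theta>" "\<theta> < 2 * pi"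
    using assms by (auto simp: left_turn_path_approaching_def)
  obtain d where d: "r * \<theta> \<le> d" and p: "left_turn_path r \<theta> d = (x, y)"
    using assms by (auto simp: left_turn_path_approaching_def)
  define s where "s = d - r * \<theta>"
  \<comment> \<open>If \<open>d = r * \<theta>\<close>, the arc branch applies; there
    \<open>s = 0\<close> and \<open>d / r = \<theta>\<close>, so both branches agree.\<close>
  have xy: "x = s * cos \<theta> + r * sin \<theta>" "y = s * sin \<theta> + r * (1 - cos \<theta>)"
    using p d r by (auto simp: left_turn_path_def s_def split: if_splits)
  have "y * cot (\<theta> / 2) = s * (sin \<theta> * cot (\<theta> / 2)) + r * ((1 - cos \<theta>) * cot (\<theta> / 2))"
    unfolding xy by (simp add: algebra_simps)
  also have "\<dots> = x + s"
    unfolding cot_half[OF \<theta>] xy by (simp add: algebra_simps)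
  finally show ?thesis
    using d by (simp add: s_def)
qed

theorem theorem7:
  fixes x y \<theta>1 \<theta>2 r1 r2 :: real
  assumes "2 * pi > \<theta>1" and "\<theta>1 > \<theta>2" and "\<theta>2 > 0"
    and "r1 = turn_radius x y \<theta>1" and "r2 = turn_radius x y \<theta>2"
    and "left_turn_path_approaching r1 \<theta>1 (x, y)"
    and "left_turn_path_approaching r2 \<theta>2 (x, y)"
  shows "turn_radius x y \<theta>1 > turn_radius x y \<theta>2"
proof -
  define t1 t2 where "t1 = cot (\<theta>1 / 2)" and "t2 = cot (\<theta>2 / 2)"
  have t: "t1 < t2"
    unfolding t1_def t2_def using assms by (intro cot_strict_antimono) auto
  have leg: "x \<le> y * t1" "x \<le> y * t2"
    using assms(6,7) by (auto simp: t1_def t2_def dest: approaching_final_leg_nonneg)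
  have "turn_radius x y \<theta>1 > 0"
    using assms(4,6) by (simp add: left_turn_path_approaching_def)
  then have nz: "\<not> (x = 0 \<and> y = 0)"
    by (auto simp: turn_radius_def)
  have "0 < (y * t1 - x) + (y * t2 - x)"
  proof (rule ccontr)
    assume "\<not> ?thesis"
    \<comment> \<open>Two nonnegative terms whose sum is not positive both vanish.\<close>
    with leg have eq: "y * t1 = x" "y * t2 = x"
      by linarith+
    with t have "y = 0"
      by (metis mult_cancel_left less_irrefl)
    with eq nz show False
      by simp
  qed
  with t have "0 < (t2 - t1) * ((y * t1 - x) + (y * t2 - x)) / 2"
    by simp
  \<comment> \<open>The difference of the two quadratics in \<open>t1\<close> and \<open>t2\<close>
    has the factor \<open>t2 - t1\<close>.\<close>
  also have "\<dots> = turn_radius x y \<theta>1 - turn_radius x y \<theta>2"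
    using assms(1-3)
    by (simp add: turn_radius_cot_half t1_def t2_def field_simps power2_eq_square)
  finally show ?thesis
    by simp
qed

end
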